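(* Let $p$ be an odd prime and $s\ge1$, $k\ge1$ integers. Then $$\rho_{k,0}(p^s)=\sum_{i=0}^{\lfloor (s-1)/2\rfloor}\Big(p^{ki}p^{(s-2i-1)(k-1)}\cdot\rho^{(1)}_{k,p^{s-2i}}(p)\Big)+p^{\lfloor s/2\rfloor k}.$$
   Context: For positive integers $k,n$ and an integer $\mu$, $\rho_{k,\mu}(n)$ is the number of $(x_1,\dots,x_k)\in(\mathbb{Z}/n\mathbb{Z})^k$ with $x_1^2+\cdots+x_k^2\equiv\mu\pmod n$. For a prime $p$, integers $t\ge1$ and $\mu$, $\rho^{(1)}_{k,\mu}(p^t)$ is the number of $(x_1,\dots,x_k)\in(\mathbb{Z}/p^t\mathbb{Z})^k$ with $x_1^2+\cdots+x_k^2\equiv\mu\pmod{p^t}$ and $p\nmid x_i$ for at least one $i$. *)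

theory Defs
  imports "HOL-Number_Theory.Cong" "HOL-Computational_Algebra.Primes" "HOL-Library.FuncSet"
begin

text \<open>
  An element of $(Z/nZ)^k$ is given by its tuple of least nonnegative representatives, indexed by
  \<open>{1..k}\<close>; the functions are extensional, so distinct functions are distinct tuples.
\<close>

definition residue_tuples :: "nat \<Rightarrow> nat \<Rightarrow> (nat \<Rightarrow> int) set" where
  "residue_tuples k n = {1..k} \<rightarrow>\<^sub>E {0..<int n}"

definition rho :: "nat \<Rightarrow> int \<Rightarrow> nat \<Rightarrow> nat" where
  "rho k \<mu> n = card {x \<in> residue_tuples k n. [(\<Sum>i=1..k. (x i)\<^sup>2) = \<mu>] (mod int n)}"

text \<open>
  The modulus of \<open>rho1 k \<mu> p t\<close> is $p^t$. The prime \<open>p\<close> and the exponent \<open>t\<close> are separate arguments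
  because the condition $p \nmid x_i$ refers to \<open>p\<close>; for $t \ge 1$ it does not depend on the
  representatives.
\<close>

definition rho1 :: "nat \<Rightarrow> int \<Rightarrow> nat \<Rightarrow> nat \<Rightarrow> nat" where
  "rho1 k \<mu> p t = card {x \<in> residue_tuples k (p ^ t).
     [(\<Sum>i=1..k. (x i)\<^sup>2) = \<mu>] (mod int (p ^ t)) \<and> (\<exists>i\<in>{1..k}. \<not> int p dvd x i)}"

end

theory Submission
  imports Defs
begin

text \<open>
  A solution of $\sum x_i^2 \equiv 0$ modulo $p^s$ is either primitive or of the form $x = p y$. The
  primitive solutions modulo $p^{t+1}$ above a primitive solution $x$ modulo $p^t$ are the
  $x + p^t z$ with $2 \sum x_i z_i \equiv -p^{-t} \sum x_i^2$ modulo $p$; this is a nonzero linear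
  equation for $z$, with $p^{k-1}$ solutions. For $s \ge 2$, the vector $p y$ is a solution iff $y$
  is one modulo $p^{s-2}$, and $y$ matters modulo $p^{s-1}$, which gives $p^k \rho_{k,0}(p^{s-2})$
  imprimitive solutions. The formula unwinds this recursion in steps of two.
\<close>

section \<open>Digit expansion of tuples\<close>

lemma int_div_less_iff_less_mult: "a div m < q \<longleftrightarrow> a < m * q" if "m > 0" for a m q :: int
  using pos_imp_zdiv_neg_iff[OF that, of "a - m * q"] div_mult_self2[of m a "- q"] that
  by simp

text \<open>Division with remainder by \<open>m\<close> in every coordinate: \<open>x\<close> holds
  the low digits, \<open>z\<close> the high ones.\<close>

lemma bij_betw_PiE_digits:
  fixes m q :: int
  assumes "m > 0" "q > 0"
  shows "bij_betw (\<lambda>(x, z). \<lambda>i\<in>I. x i + m * z i)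
    ((I \<rightarrow>\<^sub>E {0..<m}) \<times> (I \<rightarrow>\<^sub>E {0..<q})) (I \<rightarrow>\<^sub>E {0..<m * q})"
proof (rule bij_betwI[where g = "\<lambda>y. (\<lambda>i\<in>I. y i mod m, \<lambda>i\<in>I. y i div m)"])
  have bound: "a + m * b < m * q" if "a < m" "b < q" for a b
  proof -
    have "a + m * b < m * (b + 1)" using that by (simp add: algebra_simps)
    also have "\<dots> \<le> m * q" using that assms by (intro mult_left_mono) auto
    finally show ?thesis .
  qed
  show "(\<lambda>(x, z). \<lambda>i\<in>I. x i + m * z i)
      \<in> (I \<rightarrow>\<^sub>E {0..<m}) \<times> (I \<rightarrow>\<^sub>E {0..<q}) \<rightarrow> I \<rightarrow>\<^sub>E {0..<m * q}"
    using assms bound by (fastforce simp: PiE_iff)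
  show "(\<lambda>y. (\<lambda>i\<in>I. y i mod m, \<lambda>i\<in>I. y i div m))
      \<in> (I \<rightarrow>\<^sub>E {0..<m * q}) \<rightarrow> (I \<rightarrow>\<^sub>E {0..<m}) \<times> (I \<rightarrow>\<^sub>E {0..<q})"
    using assms by (auto simp: PiE_iff pos_imp_zdiv_nonneg_iff int_div_less_iff_less_mult)
  show "(\<lambda>y. (\<lambda>i\<in>I. y i mod m, \<lambda>i\<in>I. y i div m))
      ((\<lambda>(x, z). \<lambda>i\<in>I. x i + m * z i) u) = u"
    if "u \<in> (I \<rightarrow>\<^sub>E {0..<m}) \<times> (I \<rightarrow>\<^sub>E {0..<q})" for u
    using that assms by (auto simp: PiE_iff fun_eq_iff extensional_def)
  show "(\<lambda>(x, z). \<lambda>i\<in>I. x i + m * z i) (\<lambda>i\<in>I. y i mod m, \<lambda>i\<in>I. y i div m) = y"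
    if "y \<in> I \<rightarrow>\<^sub>E {0..<m * q}" for y
    using that by (auto simp: PiE_iff fun_eq_iff extensional_def)
qed

text \<open>Counting fibre by fibre over the low digits \<open>x\<close>. With \<open>q\<close> the
  prime and \<open>m\<close> a power of it, this counts the lifts of each tuple to the next
  power.\<close>

lemma card_PiE_digits:
  fixes m q :: int
  assumes "finite I" "m > 0" "q > 0"
  shows "card {y \<in> I \<rightarrow>\<^sub>E {0..<m * q}. P y} =
    (\<Sum>x \<in> I \<rightarrow>\<^sub>E {0..<m}. card {z \<in> I \<rightarrow>\<^sub>E {0..<q}. P (\<lambda>i\<in>I. x i + m * z i)})"
proof -
  let ?f = "\<lambda>(x, z). \<lambda>i\<in>I. x i + m * z i"
  let ?S = "SIGMA x : I \<rightarrow>\<^sub>E {0..<m}. {z \<in> I \<rightarrow>\<^sub>E {0..<q}. P (\<lambda>i\<in>I. x i + m * z i)}"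
  have bij: "bij_betw ?f ((I \<rightarrow>\<^sub>E {0..<m}) \<times> (I \<rightarrow>\<^sub>E {0..<q})) (I \<rightarrow>\<^sub>E {0..<m * q})"
    using assms bij_betw_PiE_digits by blast
  have "{y \<in> I \<rightarrow>\<^sub>E {0..<m * q}. P y} = ?f ` ?S"
    unfolding bij_betw_imp_surj_on[OF bij, symmetric] by force
  moreover have "inj_on ?f ?S"
    by (rule inj_on_subset[OF bij_betw_imp_inj_on[OF bij]]) auto
  ultimately have "card {y \<in> I \<rightarrow>\<^sub>E {0..<m * q}. P y} = card ?S"
    by (simp add: card_image)
  also have "\<dots> = (\<Sum>x \<in> I \<rightarrow>\<^sub>E {0..<m}. card {z \<in> I \<rightarrow>\<^sub>E {0..<q}. P (\<lambda>i\<in>I. x i + m * z i)})"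
    using assms(1) by (intro card_SigmaI) (auto intro!: finite_PiE)
  finally show ?thesis .
qed

section \<open>Linear congruences\<close>

text \<open>As \<open>a j\<close> is invertible modulo \<open>q\<close>, the coordinates other than
  \<open>j\<close> can be chosen freely, and they determine \<open>z j\<close> modulo
  \<open>q\<close>, hence as an element of \<open>{0..<q}\<close>.\<close>

lemma card_linear_cong_solutions:
  fixes q c :: int and a :: "'a \<Rightarrow> int"
  assumes "finite I" "j \<in> I" "q > 0" "coprime (a j) q"
  shows "card {z \<in> I \<rightarrow>\<^sub>E {0..<q}. [(\<Sum>i\<in>I. a i * z i) = c] (mod q)} = nat q ^ (card I - 1)"
proof -
  let ?A = "{z \<in> I \<rightarrow>\<^sub>E {0..<q}. [(\<Sum>i\<in>I. a i * z i) = c] (mod q)}"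
  let ?J = "I - {j}"
  obtain b where b: "[a j * b = 1] (mod q)"
    using assms(4) cong_solve_coprime_int by blast
  have split: "(\<Sum>i\<in>I. a i * z i) = a j * z j + (\<Sum>i\<in>?J. a i * z i)" for z
    using assms by (simp add: sum.remove)
  have solve: "[a j * y + d = c] (mod q) \<longleftrightarrow> [y = b * (c - d)] (mod q)" for y d
  proof
    assume "[a j * y + d = c] (mod q)"
    then have "[b * (a j * y + d - d) = b * (c - d)] (mod q)"
      by (intro cong_mult cong_diff) auto
    moreover have "[b * (a j * y + d - d) = y] (mod q)"
      using cong_mult[OF b cong_refl[of y]] by (simp add: mult_ac)
    ultimately show "[y = b * (c - d)] (mod q)" using cong_trans cong_sym by blast
  next
    assume "[y = b * (c - d)] (mod q)"
    then have "[a j * y + d = a j * (b * (c - d)) + d] (mod q)"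
      by (intro cong_mult cong_add) auto
    moreover have "[a j * (b * (c - d)) + d = 1 * (c - d) + d] (mod q)"
      using cong_add[OF cong_mult[OF b cong_refl[of "c - d"]] cong_refl[of d]]
      by (simp add: mult_ac)
    ultimately show "[a j * y + d = c] (mod q)" using cong_trans by fastforce
  qed
  have "bij_betw (\<lambda>z. restrict z ?J) ?A (?J \<rightarrow>\<^sub>E {0..<q})"
  \<comment> \<open>The inverse map fills in coordinate \<open>j\<close> with the least nonnegative
    solution. The sum over \<open>?J\<close> does not see this update.\<close>
  proof (rule bij_betwI[where g = "\<lambda>w. w(j := (b * (c - (\<Sum>i\<in>?J. a i * w i))) mod q)"])
    show "(\<lambda>z. restrict z ?J) \<in> ?A \<rightarrow> ?J \<rightarrow>\<^sub>E {0..<q}"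
      by (auto simp: PiE_iff)
    show "(\<lambda>w. w(j := (b * (c - (\<Sum>i\<in>?J. a i * w i))) mod q)) \<in> (?J \<rightarrow>\<^sub>E {0..<q}) \<rightarrow> ?A"
    proof (rule Pi_I)
      fix w assume w: "w \<in> ?J \<rightarrow>\<^sub>E {0..<q}"
      let ?w = "w(j := (b * (c - (\<Sum>i\<in>?J. a i * w i))) mod q)"
      have s: "(\<Sum>i\<in>?J. a i * ?w i) = (\<Sum>i\<in>?J. a i * w i)"
        by (intro sum.cong) auto
      have "[(\<Sum>i\<in>I. a i * ?w i) = c] (mod q)"
        unfolding split s solve by (simp add: cong_def)
      moreover have "?w \<in> I \<rightarrow>\<^sub>E {0..<q}"
        using w assms(2,3) by (auto simp: PiE_iff extensional_def)
      ultimately show "?w \<in> ?A" by blast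
    qed
    show "(restrict z ?J)(j := (b * (c - (\<Sum>i\<in>?J. a i * restrict z ?J i))) mod q) = z"
      if "z \<in> ?A" for z
    proof -
      have "[z j = b * (c - (\<Sum>i\<in>?J. a i * z i))] (mod q)"
        using that unfolding split solve by blast
      moreover have "z j mod q = z j"
        using that assms(2) by (auto simp: PiE_iff)
      ultimately have "(b * (c - (\<Sum>i\<in>?J. a i * z i))) mod q = z j"
        by (simp add: cong_def)
      then show ?thesis
        using that by (auto simp: fun_eq_iff PiE_iff extensional_def)
    qed
    show "restrict (w(j := (b * (c - (\<Sum>i\<in>?J. a i * w i))) mod q)) ?J = w"
      if "w \<in> ?J \<rightarrow>\<^sub>E {0..<q}" for w
      using that by (auto simp: fun_eq_iff PiE_iff extensional_def)
  qed
  then have "card ?A = card (?J \<rightarrow>\<^sub>E {0..<q})" by (rule bij_betw_same_card)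
  also have "\<dots> = nat q ^ (card I - 1)"
    using assms by (simp add: card_PiE)
  finally show ?thesis .
qed

section \<open>Lifting primitive solutions\<close>

text \<open>The part quadratic in \<open>z\<close> carries the factor \<open>m\<^sup>2\<close>, so
  modulo \<open>m\<^sup>2\<close> the sum of squares is affine in the high digits.\<close>

lemma cong_sum_squares_digits:
  fixes m :: int
  shows "[(\<Sum>i\<in>I. (x i + m * z i)\<^sup>2) = (\<Sum>i\<in>I. (x i)\<^sup>2) + m * (\<Sum>i\<in>I. 2 * x i * z i)] (mod m\<^sup>2)"
proof -
  have "(\<Sum>i\<in>I. (x i + m * z i)\<^sup>2) =
      (\<Sum>i\<in>I. (x i)\<^sup>2) + m * (\<Sum>i\<in>I. 2 * x i * z i) + m\<^sup>2 * (\<Sum>i\<in>I. (z i)\<^sup>2)"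
    by (simp add: sum.distrib sum_distrib_left power2_eq_square algebra_simps)
  then show ?thesis by (simp add: cong_def)
qed

text \<open>Modulo \<open>m\<close> the linear term vanishes as well, so the low digits alone
  decide.\<close>

lemma cong_sum_squares_digits_0:
  fixes m :: int
  shows "[(\<Sum>i\<in>I. (x i + m * z i)\<^sup>2) = 0] (mod m) \<longleftrightarrow> [(\<Sum>i\<in>I. (x i)\<^sup>2) = 0] (mod m)"
proof -
  have "[(\<Sum>i\<in>I. (x i + m * z i)\<^sup>2) = (\<Sum>i\<in>I. (x i)\<^sup>2) + m * (\<Sum>i\<in>I. 2 * x i * z i)] (mod m)"
    by (rule cong_dvd_modulus[OF cong_sum_squares_digits]) (simp add: power2_eq_square)
  then show ?thesis by (simp add: cong_def)
qed

lemma rho1_Suc: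
  assumes "prime p" "odd p" "t \<ge> 1"
  shows "rho1 k 0 p (Suc t) = p ^ (k - 1) * rho1 k 0 p t"
proof -
  define I where "I = {1..k}"
  define m where "m = int p ^ t"
  define S where "S = {x \<in> I \<rightarrow>\<^sub>E {0..<m}.
    [(\<Sum>i\<in>I. (x i)\<^sup>2) = 0] (mod m) \<and> (\<exists>i\<in>I. \<not> int p dvd x i)}"
  define P where "P y \<longleftrightarrow> [(\<Sum>i\<in>I. (y i)\<^sup>2) = 0] (mod m * int p) \<and> (\<exists>i\<in>I. \<not> int p dvd y i)" for y
  have p: "prime (int p)" "int p > 0" using assms(1) prime_gt_0_nat by auto
  \<comment> \<open>Here \<open>t \<ge> 1\<close> enters: since \<open>p\<close> divides
    \<open>m\<close>, primitivity depends on \<open>x\<close> only, and the affine expansion modulo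
    \<open>m\<^sup>2\<close> remains valid modulo \<open>m * p\<close>.\<close>
  have m: "m > 0" "int p dvd m" "m * int p dvd m\<^sup>2"
    using p assms(3) by (auto simp: m_def power2_eq_square intro!: mult_dvd_mono)
  have lifts: "card {z \<in> I \<rightarrow>\<^sub>E {0..<int p}. P (\<lambda>i\<in>I. x i + m * z i)} = (if x \<in> S then p ^ (k - 1) else 0)"
    if x: "x \<in> I \<rightarrow>\<^sub>E {0..<m}" for x
  proof -
    have prim: "(\<exists>i\<in>I. \<not> int p dvd (\<lambda>i\<in>I. x i + m * z i) i) \<longleftrightarrow> (\<exists>i\<in>I. \<not> int p dvd x i)" for z
      using m(2) by (auto simp: dvd_add_left_iff)
    have sq: "(\<Sum>i\<in>I. ((\<lambda>i\<in>I. x i + m * z i) i)\<^sup>2) = (\<Sum>i\<in>I. (x i + m * z i)\<^sup>2)" for z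
      by (intro sum.cong) auto
    show ?thesis
    proof (cases "x \<in> S")
      case False
      \<comment> \<open>A primitive solution modulo \<open>m * p\<close> would reduce to a primitive
        solution modulo \<open>m\<close>, forcing \<open>x\<close> into \<open>S\<close>.\<close>
      have "\<not> P (\<lambda>i\<in>I. x i + m * z i)" for z
      proof
        assume "P (\<lambda>i\<in>I. x i + m * z i)"
        then have *: "[(\<Sum>i\<in>I. (x i + m * z i)\<^sup>2) = 0] (mod m * int p)" "\<exists>i\<in>I. \<not> int p dvd x i"
          unfolding P_def prim sq by auto
        from *(1) have "[(\<Sum>i\<in>I. (x i + m * z i)\<^sup>2) = 0] (mod m)"
          by (rule cong_modulus_mult)
        then show False
          using *(2) x False by (simp add: S_def cong_sum_squares_digits_0)
      qed
      then show ?thesis using False by simp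
    next
      case True
      then obtain j where j: "j \<in> I" "\<not> int p dvd x j" by (auto simp: S_def)
      from True have "m dvd (\<Sum>i\<in>I. (x i)\<^sup>2)" by (simp add: S_def cong_0_iff)
      \<comment> \<open>After cancelling \<open>m\<close> from the congruence modulo
        \<open>m * p\<close>, the quotient \<open>d\<close> becomes the constant term of the linear
        congruence modulo \<open>p\<close>.\<close>
      then obtain d where d: "(\<Sum>i\<in>I. (x i)\<^sup>2) = m * d" by (elim dvdE)
      have "P (\<lambda>i\<in>I. x i + m * z i) \<longleftrightarrow> [(\<Sum>i\<in>I. 2 * x i * z i) = - d] (mod int p)" for z
      proof -
        have "[(\<Sum>i\<in>I. (x i + m * z i)\<^sup>2) = m * d + m * (\<Sum>i\<in>I. 2 * x i * z i)] (mod m * int p)"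
          using cong_dvd_modulus[OF cong_sum_squares_digits[of x m z I] m(3)] unfolding d .
        then have "P (\<lambda>i\<in>I. x i + m * z i) \<longleftrightarrow>
            [m * (d + (\<Sum>i\<in>I. 2 * x i * z i)) = 0] (mod m * int p)"
          unfolding P_def prim sq using j by (auto simp: cong_def algebra_simps)
        also have "\<dots> \<longleftrightarrow> [(\<Sum>i\<in>I. 2 * x i * z i) = - d] (mod int p)"
          using m(1) by (simp add: cong_0_iff cong_iff_dvd_diff add.commute)
        finally show ?thesis .
      qed
      \<comment> \<open>Oddness of \<open>p\<close> makes the factor 2 from the cross term
        invertible; primitivity supplies the index \<open>j\<close>.\<close>
      moreover have "coprime (2 * x j) (int p)"
      proof -
        have "\<not> int p dvd 2 * x j"
        proof
          assume "int p dvd 2 * x j"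
          then have "int p dvd 2" using j(2) p(1) prime_dvd_mult_iff by blast
          then have "p dvd 2" by (metis int_dvd_int_iff of_nat_numeral)
          then show False using assms(1,2) primes_dvd_imp_eq two_is_prime_nat by blast
        qed
        then show ?thesis using p(1) prime_imp_coprime coprime_commute by blast
      qed
      ultimately show ?thesis
        using card_linear_cong_solutions[of I j "int p" "\<lambda>i. 2 * x i" "- d"] j(1) p(2) True
        by (simp add: I_def)
    qed
  qed
  have S: "card S = rho1 k 0 p t"
    by (simp add: S_def rho1_def residue_tuples_def I_def m_def)
  have "rho1 k 0 p (Suc t) = card {y \<in> I \<rightarrow>\<^sub>E {0..<m * int p}. P y}"
    by (simp add: rho1_def residue_tuples_def I_def m_def P_def mult.commute)
  also have "\<dots> = (\<Sum>x \<in> I \<rightarrow>\<^sub>E {0..<m}. if x \<in> S then p ^ (k - 1) else 0)"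
    using lifts m p by (subst card_PiE_digits) (auto simp: I_def)
  also have "\<dots> = (\<Sum>x\<in>S. p ^ (k - 1))"
    by (rule sum.mono_neutral_cong_right) (auto simp: S_def I_def intro!: finite_PiE)
  finally show ?thesis by (simp add: S)
qed

lemma rho1_eq:
  assumes "prime p" "odd p" "s \<ge> 1"
  shows "rho1 k 0 p s = p ^ ((s - 1) * (k - 1)) * rho1 k 0 p 1"
  using assms(3)
proof (induction s rule: dec_induct)
  case (step t)
  then obtain u where "t = Suc u" by (cases t) auto
  then show ?case using rho1_Suc[OF assms(1,2) step(1)] step(3)
    by (simp add: power_add mult_ac)
qed simp

section \<open>Imprimitive solutions and the recursion\<close>

lemma PiE_unit_interval: "I \<rightarrow>\<^sub>E {0..<1::int} = {\<lambda>i\<in>I. 0}"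
proof -
  have "{0..<1::int} = {0}" by auto
  then show ?thesis by (auto simp: PiE_iff fun_eq_iff extensional_def)
qed

text \<open>Supplies the value at \<open>p ^ 0\<close>, which the recursion reaches from
  \<open>s = 2\<close>.\<close>

lemma rho_one: "rho k \<mu> 1 = 1"
proof -
  have "residue_tuples k 1 = {\<lambda>i\<in>{1..k}. 0}"
    by (simp add: residue_tuples_def PiE_unit_interval)
  then have "{x \<in> residue_tuples k 1. [(\<Sum>i=1..k. (x i)\<^sup>2) = \<mu>] (mod int 1)} = {\<lambda>i\<in>{1..k}. 0}"
    by auto
  then show ?thesis by (simp add: rho_def)
qed

text \<open>Imprimitive solutions are divided by \<open>p\<close> coordinatewise. The factor
  \<open>(int p)\<^sup>2\<close> stays uncancelled so that \<open>r = 0\<close> is covered, where it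
  exceeds the modulus and the condition is vacuous.\<close>

lemma rho_eq_primitive_plus_imprimitive:
  assumes "p > 0"
  shows "rho k 0 (p ^ Suc r) = rho1 k 0 p (Suc r) + card {y \<in> {1..k} \<rightarrow>\<^sub>E {0..<int p ^ r}.
    [(int p)\<^sup>2 * (\<Sum>i=1..k. (y i)\<^sup>2) = 0] (mod int p ^ Suc r)}"
proof -
  define I where "I = {1..k}"
  define q where "q = int p"
  define A where "A = {x \<in> I \<rightarrow>\<^sub>E {0..<q ^ Suc r}.
    [(\<Sum>i\<in>I. (x i)\<^sup>2) = 0] (mod q ^ Suc r) \<and> (\<exists>i\<in>I. \<not> q dvd x i)}"
  define B where "B = {x \<in> I \<rightarrow>\<^sub>E {0..<q ^ Suc r}.
    [(\<Sum>i\<in>I. (x i)\<^sup>2) = 0] (mod q ^ Suc r) \<and> (\<forall>i\<in>I. q dvd x i)}"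
  define Y where "Y = {y \<in> I \<rightarrow>\<^sub>E {0..<q ^ r}. [q\<^sup>2 * (\<Sum>i\<in>I. (y i)\<^sup>2) = 0] (mod q ^ Suc r)}"
  have q: "q > 0" using assms by (simp add: q_def)
  have sq: "(\<Sum>i\<in>I. (q * y i)\<^sup>2) = q\<^sup>2 * (\<Sum>i\<in>I. (y i)\<^sup>2)" for y
    by (simp add: power_mult_distrib sum_distrib_left)
  have "bij_betw (\<lambda>y. \<lambda>i\<in>I. q * y i) Y B"
  proof (rule bij_betwI[where g = "\<lambda>x. \<lambda>i\<in>I. x i div q"])
    show "(\<lambda>y. \<lambda>i\<in>I. q * y i) \<in> Y \<rightarrow> B"
      using q by (auto simp: Y_def B_def PiE_iff sq cong: sum.cong)
    show "(\<lambda>x. \<lambda>i\<in>I. x i div q) \<in> B \<rightarrow> Y"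
    proof (rule Pi_I)
      fix x assume x: "x \<in> B"
      have "(\<Sum>i\<in>I. (q * (x i div q))\<^sup>2) = (\<Sum>i\<in>I. (x i)\<^sup>2)"
        using x by (intro sum.cong) (auto simp: B_def)
      then have "[q\<^sup>2 * (\<Sum>i\<in>I. (x i div q)\<^sup>2) = 0] (mod q ^ Suc r)"
        using x by (simp add: sq B_def)
      moreover have "x i div q \<in> {0..<q ^ r}" if "i \<in> I" for i
      proof -
        have "0 \<le> x i" "x i < q * q ^ r" using x that by (auto simp: B_def PiE_iff)
        then show ?thesis using q
          by (simp add: pos_imp_zdiv_nonneg_iff int_div_less_iff_less_mult)
      qed
      ultimately show "(\<lambda>i\<in>I. x i div q) \<in> Y" by (simp add: Y_def cong: sum.cong)
    qed
  qed (use q in \<open>auto simp: Y_def B_def PiE_iff fun_eq_iff extensional_def\<close>)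
  then have "card Y = card B" by (rule bij_betw_same_card)
  moreover have "rho k 0 (p ^ Suc r) = card (A \<union> B)"
    unfolding rho_def residue_tuples_def A_def B_def I_def q_def
    by (rule arg_cong[where f = card]) auto
  moreover have "card (A \<union> B) = card A + card B"
    by (rule card_Un_disjoint) (auto simp: A_def B_def I_def intro!: finite_PiE)
  moreover have "rho1 k 0 p (Suc r) = card A"
    by (simp add: rho1_def residue_tuples_def A_def I_def q_def)
  ultimately show ?thesis by (simp add: Y_def I_def q_def)
qed

lemma rho_prime:
  assumes "prime p"
  shows "rho k 0 p = rho1 k 0 p 1 + 1"
proof -
  have "{y \<in> {1..k} \<rightarrow>\<^sub>E {0..<1}. [(int p)\<^sup>2 * (\<Sum>i=1..k. (y i)\<^sup>2) = 0] (mod int p)} =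
      {\<lambda>i\<in>{1..k}. 0}"
    by (auto simp: PiE_unit_interval cong_0_iff)
  then show ?thesis
    using rho_eq_primitive_plus_imprimitive[of p k 0] prime_gt_0_nat[OF assms] by simp
qed

text \<open>Cancelling the squared prime leaves a condition modulo \<open>p ^ r\<close> on tuples
  taken modulo \<open>p ^ Suc r\<close>. Each coordinate thus has one free top digit, whence the
  factor \<open>p ^ k\<close>.\<close>

lemma rho_Suc_Suc:
  assumes "p > 0"
  shows "rho k 0 (p ^ Suc (Suc r)) = rho1 k 0 p (Suc (Suc r)) + p ^ k * rho k 0 (p ^ r)"
proof -
  define I where "I = {1..k}"
  define m where "m = int p ^ r"
  define P where "P y \<longleftrightarrow> [(\<Sum>i\<in>I. (y i)\<^sup>2) = 0] (mod m)" for y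
  have m: "m > 0" using assms by (simp add: m_def)
  have fin: "finite I" by (simp add: I_def)
  have cancel: "[(int p)\<^sup>2 * a = 0] (mod int p ^ Suc (Suc r)) \<longleftrightarrow> [a = 0] (mod m)" for a
    using assms by (simp add: cong_0_iff m_def power2_eq_square mult.assoc)
  have digits: "P (\<lambda>i\<in>I. x i + m * z i) \<longleftrightarrow> P x" for x z
    by (simp add: P_def cong_sum_squares_digits_0 cong: sum.cong)
  have "card {y \<in> I \<rightarrow>\<^sub>E {0..<m * int p}. P y} =
      (\<Sum>x \<in> I \<rightarrow>\<^sub>E {0..<m}. card {z \<in> I \<rightarrow>\<^sub>E {0..<int p}. P x})"
    using m assms by (subst card_PiE_digits) (simp_all add: digits fin)
  also have "\<dots> = (\<Sum>x \<in> I \<rightarrow>\<^sub>E {0..<m}. if P x then p ^ k else 0)"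
    by (intro sum.cong) (auto simp: I_def card_PiE)
  also have "\<dots> = (\<Sum>x \<in> {x \<in> I \<rightarrow>\<^sub>E {0..<m}. P x}. p ^ k)"
    by (rule sum.mono_neutral_cong_right) (auto simp: I_def intro!: finite_PiE)
  also have "\<dots> = p ^ k * rho k 0 (p ^ r)"
    by (simp add: rho_def residue_tuples_def P_def I_def m_def)
  finally show ?thesis
    using rho_eq_primitive_plus_imprimitive[OF assms, of k "Suc r"] unfolding cancel
    by (simp add: P_def I_def m_def mult.commute)
qed

section \<open>Unwinding the recursion\<close>

text \<open>Strong induction in steps of two. The case \<open>s = 2\<close> is separate because the
  recursion then lands on exponent 0, outside the range \<open>s \<ge> 1\<close> of the induction
  hypothesis.\<close>

lemma rho_prime_power:
  assumes "prime p" "odd p" "s \<ge> 1"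
  shows "rho k 0 (p ^ s) = (\<Sum>i = 0..(s - 1) div 2.
    p ^ (k * i) * p ^ ((s - 2 * i - 1) * (k - 1)) * rho1 k 0 p 1) + p ^ ((s div 2) * k)"
  using assms(3)
proof (induction s rule: less_induct)
  case (less s)
  have p: "p > 0" using assms(1) prime_gt_0_nat by blast
  consider "s = 1" | "s = 2" | r where "s = Suc (Suc r)" "r \<ge> 1"
    using less.prems by (metis One_nat_def Suc_1 Suc_le_D le_zero_eq not_less_eq_eq)
  then show ?case
  proof cases
    case 1
    then show ?thesis using rho_prime[OF assms(1)] by simp
  next
    case 2
    have "rho k 0 (p ^ 2) = rho1 k 0 p 2 + p ^ k"
      using rho_Suc_Suc[OF p, of k 0] rho_one[of k 0] by (simp add: numeral_2_eq_2)
    then show ?thesis using rho1_eq[OF assms(1,2), of 2 k] 2 by simp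
  next
    case (3 r)
    \<comment> \<open>The first equation relies on \<open>r \<ge> 1\<close>: for
      \<open>r = 0\<close> the truncated subtraction \<open>r - 1\<close> would break it.\<close>
    have half: "(s - 1) div 2 = Suc ((r - 1) div 2)" "s div 2 = Suc (r div 2)"
      using 3 by auto
    let ?f = "\<lambda>s i. p ^ (k * i) * p ^ ((s - 2 * i - 1) * (k - 1)) * rho1 k 0 p 1"
    have "rho k 0 (p ^ s) = rho1 k 0 p s + p ^ k * rho k 0 (p ^ r)"
      using rho_Suc_Suc[OF p] 3 by simp
    also have "rho1 k 0 p s = ?f s 0"
      using rho1_eq[OF assms(1,2) less.prems] by simp
    also have "rho k 0 (p ^ r) = (\<Sum>i = 0..(r - 1) div 2. ?f r i) + p ^ ((r div 2) * k)"
      using less.IH[of r] 3 by simp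
    \<comment> \<open>Multiplying by \<open>p ^ k\<close> turns term \<open>i\<close> for
      \<open>r\<close> into term \<open>Suc i\<close> for \<open>s\<close>, since
      \<open>s - 2 * Suc i = r - 2 * i\<close>.\<close>
    also have "?f s 0 + p ^ k * \<dots> =
        ?f s 0 + (\<Sum>i = 0..(r - 1) div 2. ?f s (Suc i)) + p ^ ((s div 2) * k)"
      using 3 by (simp add: half power_add sum_distrib_left algebra_simps)
    also have "?f s 0 + (\<Sum>i = 0..(r - 1) div 2. ?f s (Suc i)) = (\<Sum>i = 0..(s - 1) div 2. ?f s i)"
      unfolding half by (simp only: atLeast0AtMost sum.atMost_Suc_shift)
    finally show ?thesis .
  qed
qed

lemma rho1_cong:
  assumes "[\<mu> = \<nu>] (mod int (p ^ t))"
  shows "rho1 k \<mu> p t = rho1 k \<nu> p t"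
  using assms unfolding rho1_def cong_def by simp

theorem theorem2:
  fixes p s k :: nat
  assumes "prime p" and "odd p" and "s \<ge> 1" and "k \<ge> 1"
  shows "rho k 0 (p ^ s) =
    (\<Sum>i = 0..(s - 1) div 2.
       p ^ (k * i) * p ^ ((s - 2 * i - 1) * (k - 1)) * rho1 k (int (p ^ (s - 2 * i))) p 1)
    + p ^ ((s div 2) * k)"
proof -
  have "rho1 k (int (p ^ (s - 2 * i))) p 1 = rho1 k 0 p 1" if "i \<in> {0..(s - 1) div 2}" for i
  proof (rule rho1_cong)
    \<comment> \<open>The upper summation limit keeps the exponent positive, so \<open>p\<close>
      divides the target value \<open>p ^ (s - 2 * i)\<close>.\<close>
    have "s - 2 * i > 0" using that assms(3) by auto
    then show "[int (p ^ (s - 2 * i)) = 0] (mod int (p ^ 1))"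
      by (simp add: cong_0_iff)
  qed
  then show ?thesis
    unfolding rho_prime_power[OF assms(1-3)] by simp
qed

end
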